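(* Let $\phi(\cdot\,;a)\colon\mathbb{R}\to\mathbb{R}$, $a\geq 0$, be a parameterized penalty function satisfying the Penalty Assumption, let $m\geq n$, and let $A\in\mathbb{R}^{m\times n}$ satisfy $A^{T}A=rI$ with $r>0$. Let $y\in\mathbb{R}^n$, and let $\lambda_i>0$ for $i=1,\dots,m$. Then the function $F\colon\mathbb{R}^n\to\mathbb{R}$ defined by $$F(x)=\frac12\|y-x\|_2^2+\sum_{i=1}^{m}\lambda_i\,\phi\big([Ax]_i;a_i\big)$$ is strictly convex if $$0\leq a_i<\frac{1}{r\lambda_i},\qquad i=1,\dots,m.$$
   Context: Penalty Assumption: $\phi(\cdot\,;a)\colon\mathbb{R}\to\mathbb{R}$ is a family of functions parameterized by $a\geq 0$ (primes denote derivatives in $x$, and $0^+$ denotes the limit as $x\to 0$ from the right) such that (1) $\phi(\cdot\,;a)$ is continuous on $\mathbb{R}$, twice differentiable on $\mathbb{R}\setminus\{0\}$, and symmetric: $\phi(-x;a)=\phi(x;a)$; (2) $\phi'(x;a)>0$ for all $x>0$; (3) $\phi''(x;a)\leq 0$ for all $x>0$; (4) $\phi'(0^+;a)=1$; (5) $\inf_{x\neq 0}\phi''(x;a)=\phi''(0^+;a)=-a$; (6) $\phi(x;0)=|x|$. $[Ax]_i$ denotes the $i$-th component of the vector $Ax\in\mathbb{R}^m$. *)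

theory Defs
  imports "HOL-Analysis.Analysis"
begin

text \<open>
  The parameter comes first: \<open>\<phi> a x\<close> stands for \<open>\<phi>(x; a)\<close>. The condition on the infimum requires \<open>bdd_below\<close>
  separately, since \<open>Inf\<close> of an unbounded set of reals is an unspecified value.
\<close>

definition penalty_assumption :: "(real \<Rightarrow> real \<Rightarrow> real) \<Rightarrow> bool"
  where "penalty_assumption \<phi> \<longleftrightarrow>
    (\<forall>a\<ge>0.
      continuous_on UNIV (\<phi> a) \<and>
      (\<forall>x. x \<noteq> 0 \<longrightarrow> \<phi> a differentiable (at x) \<and> deriv (\<phi> a) differentiable (at x)) \<and>
      (\<forall>x. \<phi> a (- x) = \<phi> a x) \<and>
      (\<forall>x>0. deriv (\<phi> a) x > 0) \<and>
      (\<forall>x>0. deriv (deriv (\<phi> a)) x \<le> 0) \<and>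
      (deriv (\<phi> a) \<longlongrightarrow> 1) (at_right 0) \<and>
      bdd_below (deriv (deriv (\<phi> a)) ` (- {0})) \<and>
      (INF x\<in>- {0}. deriv (deriv (\<phi> a)) x) = - a \<and>
      (deriv (deriv (\<phi> a)) \<longlongrightarrow> - a) (at_right 0)) \<and>
    (\<forall>x. \<phi> 0 x = \<bar>x\<bar>)"

definition strictly_convex_on :: "'a::real_vector set \<Rightarrow> ('a \<Rightarrow> real) \<Rightarrow> bool"
  where "strictly_convex_on S f \<longleftrightarrow> convex S \<and>
    (\<forall>x\<in>S. \<forall>y\<in>S. x \<noteq> y \<longrightarrow>
      (\<forall>u>0. \<forall>v>0. u + v = 1 \<longrightarrow> f (u *\<^sub>R x + v *\<^sub>R y) < u * f x + v * f y))"

end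

theory Submission
  imports Defs
begin

text \<open>
  Since \<open>transpose A ** A = r *\<^sub>R mat 1\<close>, the quadratic term is, up to an affine function,
  \<open>\<Sum>i. ((A *v x) $ i)\<^sup>2 / (2 * r)\<close>, so the objective becomes an affine function plus a sum of functions
  \<open>g\<^sub>i t = t\<^sup>2 / (2 * r) + l i * \<phi> (a i) t\<close> of the single components of \<open>A *v x\<close>. Each \<open>g\<^sub>i\<close> is strictly convex
  because \<open>\<phi> (a i) t + a i / 2 * t\<^sup>2\<close> is convex and \<open>l i * a i < 1 / r\<close>; injectivity of \<open>A\<close> makes the sum
  strictly convex. The kink at \<open>0\<close> is harmless: an even function that is nondecreasing and convex on
  the half line is convex, being its composition with the absolute value.
\<close>

lemma convex_on_real_even:
  fixes f :: "real \<Rightarrow> real"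
  assumes conv: "convex_on {0..} f" and mono: "mono_on {0..} f" and even: "\<And>x. f (- x) = f x"
  shows "convex_on UNIV f"
proof -
  have abs: "f x = f \<bar>x\<bar>" for x
    using even by (cases "x \<ge> 0") (auto simp: abs_if)
  have "f (u * x + v * y) \<le> u * f x + v * f y" if "0 \<le> u" "0 \<le> v" "u + v = 1" for u v x y
  proof -
    \<comment> \<open>Taking absolute values of both points can only enlarge the combination, and
      monotonicity on the half line turns this into an upper bound for \<open>f\<close>.\<close>
    have "\<bar>u * x + v * y\<bar> \<le> u * \<bar>x\<bar> + v * \<bar>y\<bar>"
      using that abs_triangle_ineq[of "u * x" "v * y"] by (simp add: abs_mult)
    then have "f \<bar>u * x + v * y\<bar> \<le> f (u * \<bar>x\<bar> + v * \<bar>y\<bar>)"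
      using that by (intro mono_onD[OF mono]) auto
    also have "\<dots> \<le> u * f \<bar>x\<bar> + v * f \<bar>y\<bar>"
      using conv that unfolding convex_on_def by auto
    finally show ?thesis
      using abs by metis
  qed
  then show ?thesis
    by (auto simp: convex_on_def)
qed

lemma convex_on_atLeast_if_greaterThan:
  fixes f :: "real \<Rightarrow> real"
  assumes conv: "convex_on {c<..} f" and cont: "continuous_on UNIV f"
  shows "convex_on {c..} f"
proof -
  have "f (u * x + v * y) \<le> u * f x + v * f y"
    if "0 \<le> u" "0 \<le> v" "u + v = 1" "c \<le> x" "c \<le> y" for u v x y
  proof -
    have isCont: "isCont f x" for x
      using cont by (simp add: continuous_on_eq_continuous_at)
    have lim: "((\<lambda>s. f (z + s)) \<longlongrightarrow> f z) (at_right 0)" for z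
    proof -
      have "((\<lambda>s. z + s) \<longlongrightarrow> z + 0) (at_right 0)"
        by (intro tendsto_intros)
      then show ?thesis
        using isCont_tendsto_compose[OF isCont[of z]] by auto
    qed
    have "\<forall>\<^sub>F s in at_right 0. f ((u * x + v * y) + s) \<le> u * f (x + s) + v * f (y + s)"
      using eventually_at_right_less[of 0]
    proof eventually_elim
      case (elim s)
      have "f (u * (x + s) + v * (y + s)) \<le> u * f (x + s) + v * f (y + s)"
        using conv that elim unfolding convex_on_def by auto
      moreover have "u * (x + s) + v * (y + s) = (u * x + v * y) + (u + v) * s"
        by (simp add: algebra_simps)
      ultimately show ?case
        using that by simp
    qed
    moreover have "((\<lambda>s. u * f (x + s) + v * f (y + s)) \<longlongrightarrow> u * f x + v * f y) (at_right 0)"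
      by (intro tendsto_add tendsto_mult tendsto_const lim)
    ultimately show ?thesis
      using lim by (intro tendsto_le[OF trivial_limit_at_right_real])
  qed
  then show ?thesis
    by (auto simp: convex_on_def)
qed

text \<open>The infimum condition bounds the second derivative of \<open>\<phi> a\<close> below by
  \<open>- a\<close> away from 0, and the added quadratic contributes exactly
  \<open>a\<close>.\<close>

lemma penalty_plus_quadratic_convex:
  assumes pen: "penalty_assumption \<phi>" and "a \<ge> 0"
  shows "convex_on UNIV (\<lambda>t. \<phi> a t + a / 2 * t\<^sup>2)"
proof -
  let ?h = "\<lambda>t. \<phi> a t + a / 2 * t\<^sup>2" and ?h' = "\<lambda>t. deriv (\<phi> a) t + a * t"
  have cont: "continuous_on UNIV (\<phi> a)"
    and diff: "\<And>x. x \<noteq> 0 \<Longrightarrow> \<phi> a differentiable (at x)"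
      "\<And>x. x \<noteq> 0 \<Longrightarrow> deriv (\<phi> a) differentiable (at x)"
    and even: "\<And>x. \<phi> a (- x) = \<phi> a x"
    and pos: "\<And>x. x > 0 \<Longrightarrow> deriv (\<phi> a) x > 0"
    and bdd: "bdd_below (deriv (deriv (\<phi> a)) ` (- {0}))"
    and inf: "(INF x\<in>- {0}. deriv (deriv (\<phi> a)) x) = - a"
    using pen \<open>a \<ge> 0\<close> unfolding penalty_assumption_def by auto
  have h_cont: "continuous_on UNIV ?h"
    using cont by (intro continuous_intros)
  have h': "(?h has_real_derivative ?h' x) (at x)" if "x > 0" for x
    using diff(1)[of x] that
    by (auto intro!: derivative_eq_intros simp flip: DERIV_deriv_iff_real_differentiable)
  have h'': "(?h' has_real_derivative deriv (deriv (\<phi> a)) x + a) (at x)" if "x > 0" for x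
    using diff(2)[of x] that
    by (auto intro!: derivative_eq_intros simp flip: DERIV_deriv_iff_real_differentiable)
  have h''_nonneg: "deriv (deriv (\<phi> a)) x + a \<ge> 0" if "x > 0" for x
    using cINF_lower[OF bdd, of x] that unfolding inf by simp
  have "convex_on {0<..} ?h"
    by (rule f''_ge0_imp_convex[OF _ h' h'' h''_nonneg]) auto
  then have "convex_on {0..} ?h"
    using h_cont by (rule convex_on_atLeast_if_greaterThan)
  moreover have "mono_on {0..} ?h"
  proof (rule mono_onI)
    fix p q :: real
    assume pq: "p \<in> {0..}" "p \<le> q"
    \<comment> \<open>If \<open>p = 0\<close>, there may be a kink at the left end, so derivatives
      are taken only beyond \<open>p\<close>; continuity covers the endpoints.\<close>
    have "\<exists>D. (?h has_real_derivative D) (at x) \<and> D \<ge> 0" if "p < x" for x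
      using h'[of x] pos[of x] that pq \<open>a \<ge> 0\<close> by (intro exI[of _ "?h' x"]) simp
    then show "?h p \<le> ?h q"
      using pq continuous_on_subset[OF h_cont]
      by (intro DERIV_nonneg_imp_increasing_open[where f = ?h]) blast+
  qed
  ultimately show ?thesis
    by (rule convex_on_real_even) (simp add: even)
qed

text \<open>Completing \<open>l * \<phi> a t\<close> to a convex function uses up
  \<open>l * a\<close> of the curvature \<open>c\<close>; the remaining \<open>c - l * a > 0\<close>
  gives strictness.\<close>

lemma strictly_convex_on_quadratic_plus_penalty:
  assumes "penalty_assumption \<phi>" and "l > 0" and "a \<ge> 0" and "l * a < c"
  shows "strictly_convex_on UNIV (\<lambda>t. c / 2 * t\<^sup>2 + l * \<phi> a t)"
proof -
  let ?h = "\<lambda>t. \<phi> a t + a / 2 * t\<^sup>2" and ?g = "\<lambda>t. c / 2 * t\<^sup>2 + l * \<phi> a t"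
  have g: "?g t = l * ?h t + (c - l * a) / 2 * t\<^sup>2" for t
    by (simp add: field_simps)
  have "?g (u * s + v * t) < u * ?g s + v * ?g t"
    if "s \<noteq> t" "u > 0" "v > 0" "u + v = 1" for s t u v
  proof -
    have "?h (u * s + v * t) \<le> u * ?h s + v * ?h t"
      using penalty_plus_quadratic_convex[OF assms(1,3)] that unfolding convex_on_def by auto
    then have "l * ?h (u * s + v * t) \<le> l * (u * ?h s + v * ?h t)"
      using \<open>l > 0\<close> by simp
    moreover have "(u * s + v * t)\<^sup>2 < u * s\<^sup>2 + v * t\<^sup>2"
    proof -
      have v: "v = 1 - u"
        using that by simp
      \<comment> \<open>The convexity gap of the square is the variance of a two-point distribution
        with weights \<open>u\<close> and \<open>v\<close>.\<close>
      have "u * s\<^sup>2 + v * t\<^sup>2 - (u * s + v * t)\<^sup>2 = u * v * (s - t)\<^sup>2"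
        unfolding v by algebra
      also have "\<dots> > 0"
        using that by simp
      finally show ?thesis
        by simp
    qed
    then have "(c - l * a) / 2 * (u * s + v * t)\<^sup>2 < (c - l * a) / 2 * (u * s\<^sup>2 + v * t\<^sup>2)"
      using \<open>l * a < c\<close> by (intro mult_strict_left_mono) auto
    moreover have "u * (l * ?h s + (c - l * a) / 2 * s\<^sup>2) + v * (l * ?h t + (c - l * a) / 2 * t\<^sup>2)
        = l * (u * ?h s + v * ?h t) + (c - l * a) / 2 * (u * s\<^sup>2 + v * t\<^sup>2)"
      by (simp only: distrib_left mult_ac add_ac)
    ultimately show ?thesis
      unfolding g by linarith
  qed
  then show ?thesis
    by (auto simp: strictly_convex_on_def)
qed

text \<open>Distinct points have distinct images under \<open>A\<close>, which differ in some
  component; that summand is strict, and the others are at least weakly convex.\<close>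

lemma strictly_convex_on_sum_components:
  fixes A :: "real ^ 'n ^ 'm" and g :: "'m \<Rightarrow> real \<Rightarrow> real"
  assumes "inj ((*v) A)" and g: "\<And>i. strictly_convex_on UNIV (g i)"
  shows "strictly_convex_on UNIV (\<lambda>x. \<Sum>i\<in>UNIV. g i ((A *v x) $ i))"
proof -
  have "(\<Sum>i\<in>UNIV. g i ((A *v (u *\<^sub>R x + v *\<^sub>R z)) $ i))
      < u * (\<Sum>i\<in>UNIV. g i ((A *v x) $ i)) + v * (\<Sum>i\<in>UNIV. g i ((A *v z) $ i))"
    if "x \<noteq> z" "u > 0" "v > 0" "u + v = 1" for x z u v
  proof -
    have eq: "(A *v (u *\<^sub>R x + v *\<^sub>R z)) $ i = u * (A *v x) $ i + v * (A *v z) $ i" for i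
      by (simp add: matrix_vector_right_distrib matrix_vector_mult_scaleR)
    have less: "g i (u * s + v * t) < u * g i s + v * g i t" if "s \<noteq> t" for i s t
      using g[of i] that \<open>u > 0\<close> \<open>v > 0\<close> \<open>u + v = 1\<close> by (auto simp: strictly_convex_on_def)
    have le: "g i (u * s + v * t) \<le> u * g i s + v * g i t" for i s t
      using less[of s t i] \<open>u + v = 1\<close> by (cases "s = t") (auto simp flip: distrib_right)
    from \<open>inj ((*v) A)\<close> \<open>x \<noteq> z\<close> have "A *v x \<noteq> A *v z"
      by (auto dest: injD)
    then obtain k where "(A *v x) $ k \<noteq> (A *v z) $ k"
      by (auto simp: vec_eq_iff)
    then have "(\<Sum>i\<in>UNIV. g i (u * (A *v x) $ i + v * (A *v z) $ i))
        < (\<Sum>i\<in>UNIV. u * g i ((A *v x) $ i) + v * g i ((A *v z) $ i))"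
      by (intro sum_strict_mono_ex1 ballI le bexI[of _ k] less) auto
    then show ?thesis
      by (simp add: eq sum.distrib sum_distrib_left)
  qed
  then show ?thesis
    by (auto simp: strictly_convex_on_def)
qed

text \<open>Moving \<open>A\<close> across the inner product produces
  \<open>transpose A ** A\<close>. The identity serves both to rewrite the quadratic term and to
  show that \<open>A\<close> is injective.\<close>

lemma norm_matrix_vector_mult_scaled_orthogonal:
  fixes A :: "real ^ 'n ^ 'm"
  assumes "transpose A ** A = r *\<^sub>R mat 1"
  shows "(norm (A *v x))\<^sup>2 = r * (norm x)\<^sup>2"
proof -
  have "(norm (A *v x))\<^sup>2 = ((A *v x) v* A) \<bullet> x"
    by (simp add: power2_norm_eq_inner dot_lmul_matrix)
  also have "(A *v x) v* A = (transpose A ** A) *v x"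
    by (simp flip: transpose_matrix_vector add: matrix_vector_mul_assoc)
  also have "\<dots> = r *\<^sub>R x"
    by (simp add: assms flip: scaleR_matrix_vector_assoc)
  finally show ?thesis
    by (simp add: power2_norm_eq_inner)
qed

theorem theorem1:
  fixes \<phi> :: "real \<Rightarrow> real \<Rightarrow> real"
    and A :: "real ^ 'n ^ 'm"
    and r :: real
    and y :: "real ^ 'n"
    and l :: "'m \<Rightarrow> real"
    and a :: "'m \<Rightarrow> real"
  assumes "penalty_assumption \<phi>"
    and "CARD('m) \<ge> CARD('n)"
    and "transpose A ** A = r *\<^sub>R mat 1"
    and "r > 0"
    and "\<And>i. l i > 0"
    and "\<And>i. 0 \<le> a i \<and> a i < 1 / (r * l i)"
  shows "strictly_convex_on UNIV
    (\<lambda>x. 1 / 2 * (norm (y - x))\<^sup>2 + (\<Sum>i\<in>UNIV. l i * \<phi> (a i) ((A *v x) $ i)))"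
proof -
  \<comment> \<open>The weight \<open>1 / r / 2\<close> makes the squared components of
    \<open>A *v x\<close> sum to half the squared norm of \<open>x\<close>.\<close>
  define g where "g = (\<lambda>i t. 1 / r / 2 * t\<^sup>2 + l i * \<phi> (a i) t)"
  define G where "G = (\<lambda>x. \<Sum>i\<in>UNIV. g i ((A *v x) $ i))"
  note norm_A = norm_matrix_vector_mult_scaled_orthogonal[OF assms(3)]
  have "strictly_convex_on UNIV (g i)" for i
  proof -
    have "l i * a i < 1 / r"
      using assms(4) assms(5)[of i] assms(6)[of i] by (simp add: field_simps)
    then show ?thesis
      unfolding g_def using assms(1,5,6)
      by (intro strictly_convex_on_quadratic_plus_penalty) auto
  qed
  moreover have "inj ((*v) A)"
  proof (rule injI)
    fix x z
    assume "A *v x = A *v z"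
    then show "x = z"
      using norm_A[of "x - z"] \<open>r > 0\<close> by (simp add: matrix_vector_mult_diff_distrib)
  qed
  ultimately have "strictly_convex_on UNIV G"
    unfolding G_def by (rule strictly_convex_on_sum_components[rotated])
  moreover have F: "1 / 2 * (norm (y - x))\<^sup>2 + (\<Sum>i\<in>UNIV. l i * \<phi> (a i) ((A *v x) $ i))
      = (norm y)\<^sup>2 / 2 - y \<bullet> x + G x" for x
  proof -
    have "1 / 2 * (norm x)\<^sup>2 = 1 / r / 2 * (norm (A *v x))\<^sup>2"
      using \<open>r > 0\<close> by (simp add: norm_A)
    also have "(norm (A *v x))\<^sup>2 = (\<Sum>i\<in>UNIV. ((A *v x) $ i)\<^sup>2)"
      unfolding power2_norm_eq_inner by (simp add: inner_vec_def power2_eq_square)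
    finally have "G x = 1 / 2 * (norm x)\<^sup>2 + (\<Sum>i\<in>UNIV. l i * \<phi> (a i) ((A *v x) $ i))"
      by (simp add: G_def g_def sum.distrib sum_distrib_left)
    moreover have "(norm (y - x))\<^sup>2 = (norm y)\<^sup>2 - 2 * (y \<bullet> x) + (norm x)\<^sup>2"
      by (simp add: power2_norm_eq_inner inner_diff inner_commute)
    ultimately show ?thesis
      by (simp add: field_simps)
  qed
  \<comment> \<open>The affine part satisfies the convexity inequality with equality, its constant
    term because \<open>u + v = 1\<close>, so the strictness of \<open>G\<close> carries
    over.\<close>
  moreover have "(norm y)\<^sup>2 / 2 - y \<bullet> (u *\<^sub>R x + v *\<^sub>R z) + G (u *\<^sub>R x + v *\<^sub>R z)
      < u * ((norm y)\<^sup>2 / 2 - y \<bullet> x + G x) + v * ((norm y)\<^sup>2 / 2 - y \<bullet> z + G z)"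
    if "G (u *\<^sub>R x + v *\<^sub>R z) < u * G x + v * G z" "u + v = 1" for u v x z
  proof -
    have "u * ((norm y)\<^sup>2 / 2) + v * ((norm y)\<^sup>2 / 2) = (norm y)\<^sup>2 / 2"
      using that(2) by (simp flip: distrib_right)
    then show ?thesis
      using that(1) by (simp add: inner_add_right right_diff_distrib distrib_left)
  qed
  ultimately show ?thesis
    by (simp only: F strictly_convex_on_def) blast
qed

end
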